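(* Let $\varphi\in L^\infty(\mathbb{T})$. With respect to the decomposition $\mathcal{M}^\perp=\mathcal{N}\oplus H^2_-$, the operator $D_\varphi^{\mathcal{M}}$ has the block matrix representation $$D_\varphi^{\mathcal{M}}=\begin{bmatrix} T_\varphi^{\mathcal{N}} & P_{\mathcal{N}}H_{\bar\varphi}^*\\ H_\varphi|_{\mathcal{N}} & S_\varphi\end{bmatrix},$$ where $T_\varphi^{\mathcal{N}}=P_{\mathcal{N}}M_\varphi|_{\mathcal{N}}$, $S_\varphi=P_-M_\varphi|_{H^2_-}$, $H_\varphi=P_-M_\varphi|_{H^2}$, and $H_{\bar\varphi}^*=P_+M_\varphi|_{H^2_-}$.
   Context: $\mathbb{D}$ is the open unit disk, $\mathbb{T}=\partial\mathbb{D}$, and $L^2(\mathbb{T})$ is taken with respect to normalized Lebesgue measure $m$, with inner product linear in the first variable. $H^2\subset L^2(\mathbb{T})$ is the Hardy space (functions with vanishing negative Fourier coefficients, also viewed as analytic functions on $\mathbb{D}$), $H^2_-=L^2(\mathbb{T})\ominus H^2$, and $P_+,P_-$ are the orthogonal projections of $L^2(\mathbb{T})$ onto $H^2$ and $H^2_-$. For $f\in H^2$, $S^*f=(f-f(0))/z$. For an inner function $u$, $\mathcal{K}_u=H^2\ominus uH^2$. A closed subspace $\mathcal{M}\subset H^2$ is nearly $S^*$-invariant if $f\in\mathcal{M}$, $f(0)=0$ imply $S^*f\in\mathcal{M}$. Setting: $\mathcal{M}=h\mathcal{K}_u$ is a nonzero proper closed nearly $S^*$-invariant subspace of $H^2$,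 where $u$ is a nonconstant inner function with $u(0)=0$ and $h\in\mathcal{M}$ is the extremal function of $\mathcal{M}$: $\|h\|_2=1$, $h(0)>0$, $h\perp\{f\in\mathcal{M}:f(0)=0\}$, and multiplication by $h$ is an isometry from $\mathcal{K}_u$ onto $\mathcal{M}$. $\mathcal{M}^\perp=L^2(\mathbb{T})\ominus\mathcal{M}$, $\mathcal{N}=H^2\ominus\mathcal{M}$, and $P_{\mathcal{M}^\perp},P_{\mathcal{N}}$ are the corresponding orthogonal projections. $M_\varphi f=\varphi f$ on $L^2(\mathbb{T})$, and $D_\varphi^{\mathcal{M}}=P_{\mathcal{M}^\perp}M_\varphi|_{\mathcal{M}^\perp}$. For $\alpha\in L^\infty(\mathbb{T})$, the Hankel operator is $H_\alpha:H^2\to H^2_-$, $H_\alpha f=P_-(\alpha f)$. *)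

theory Defs
  imports "HOL-Analysis.Analysis"
begin

section \<open>The Hilbert space of square-integrable functions on the unit circle\<close>

text \<open>Normalized Lebesgue measure \<open>m\<close>, realised as a Borel measure on the complex plane
  concentrated on the unit circle.\<close>

definition circle_measure :: "complex measure"
  where "circle_measure = distr (uniform_measure lborel {0..<2 * pi}) borel cis"

definition square_integrable :: "(complex \<Rightarrow> complex) \<Rightarrow> bool"
  where "square_integrable f \<longleftrightarrow>
    f \<in> borel_measurable circle_measure \<and> integrable circle_measure (\<lambda>z. (norm (f z))\<^sup>2)"

definition l2_rel :: "(complex \<Rightarrow> complex) \<Rightarrow> (complex \<Rightarrow> complex) \<Rightarrow> bool"
  where "l2_rel f g \<longleftrightarrow>
    square_integrable f \<and> square_integrable g \<and> (AE z in circle_measure. f z = g z)"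

lemma space_circle_measure [simp]: "space circle_measure = UNIV"
  and sets_circle_measure [simp, measurable_cong]: "sets circle_measure = sets borel"
  by (simp_all add: circle_measure_def)

lemma borel_measurable_cnj [measurable]: "cnj \<in> borel_measurable borel"
  by (intro borel_measurable_continuous_onI continuous_intros)

lemma square_integrable_zero [simp]: "square_integrable (\<lambda>z. 0)"
  by (simp add: square_integrable_def)

lemma square_integrable_AE_cong:
  assumes "f \<in> borel_measurable circle_measure" "g \<in> borel_measurable circle_measure"
    and "AE z in circle_measure. f z = g z"
  shows "square_integrable f \<longleftrightarrow> square_integrable g"
proof -
  have "integrable circle_measure (\<lambda>z. (norm (f z))\<^sup>2)
    \<longleftrightarrow> integrable circle_measure (\<lambda>z. (norm (g z))\<^sup>2)"
    using assms by (intro integrable_cong_AE) auto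
  then show ?thesis
    using assms by (simp add: square_integrable_def)
qed

lemma square_integrable_add:
  assumes "square_integrable f" "square_integrable g"
  shows "square_integrable (\<lambda>z. f z + g z)"
proof -
  have [measurable]: "f \<in> borel_measurable circle_measure" "g \<in> borel_measurable circle_measure"
    using assms by (auto simp: square_integrable_def)
  have "(norm (f z + g z))\<^sup>2 \<le> 2 * (norm (f z))\<^sup>2 + 2 * (norm (g z))\<^sup>2" for z
  proof -
    have "(norm (f z + g z))\<^sup>2 \<le> (norm (f z) + norm (g z))\<^sup>2"
      by (intro power_mono norm_triangle_ineq) auto
    also have "\<dots> \<le> 2 * (norm (f z))\<^sup>2 + 2 * (norm (g z))\<^sup>2"
      using sum_squares_bound[of "norm (f z)" "norm (g z)"] by (simp add: power2_sum)
    finally show ?thesis .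
  qed
  then have bound: "norm ((norm (f z + g z))\<^sup>2) \<le> norm (2 * (norm (f z))\<^sup>2 + 2 * (norm (g z))\<^sup>2)" for z
    by simp
  have "integrable circle_measure (\<lambda>z. 2 * (norm (f z))\<^sup>2 + 2 * (norm (g z))\<^sup>2)"
    using assms unfolding square_integrable_def
    by (intro Bochner_Integration.integrable_add integrable_mult_right) simp_all
  then have "integrable circle_measure (\<lambda>z. (norm (f z + g z))\<^sup>2)"
    by (rule Bochner_Integration.integrable_bound) (measurable, rule AE_I2, rule bound)
  then show ?thesis
    by (simp add: square_integrable_def)
qed

lemma square_integrable_cmult:
  assumes "square_integrable f"
  shows "square_integrable (\<lambda>z. c * f z)" and "square_integrable (\<lambda>z. f z * c)"
  using assms by (auto simp: square_integrable_def norm_mult power_mult_distrib)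

lemma square_integrable_cnj:
  assumes "square_integrable f"
  shows "square_integrable (\<lambda>z. cnj (f z))"
  using assms by (auto simp: square_integrable_def intro: measurable_compose[OF _ borel_measurable_cnj])

lemma integrable_mult_cnj:
  assumes "square_integrable f" "square_integrable g"
  shows "integrable circle_measure (\<lambda>z. f z * cnj (g z))"
proof -
  have [measurable]: "f \<in> borel_measurable circle_measure" "g \<in> borel_measurable circle_measure"
    using assms by (auto simp: square_integrable_def)
  have bound: "norm (f z * cnj (g z)) \<le> norm ((norm (f z))\<^sup>2 + (norm (g z))\<^sup>2)" for z
  proof -
    have "norm (f z) * norm (g z) \<le> 2 * norm (f z) * norm (g z)"
      by simp
    also have "\<dots> \<le> (norm (f z))\<^sup>2 + (norm (g z))\<^sup>2"
      by (rule sum_squares_bound)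
    finally show ?thesis
      by (simp add: norm_mult)
  qed
  have [measurable]: "(\<lambda>z. cnj (g z)) \<in> borel_measurable circle_measure"
    by (rule measurable_compose[OF _ borel_measurable_cnj]) fact
  have "integrable circle_measure (\<lambda>z. (norm (f z))\<^sup>2 + (norm (g z))\<^sup>2)"
    using assms unfolding square_integrable_def
    by (intro Bochner_Integration.integrable_add) simp_all
  then show ?thesis
    by (rule Bochner_Integration.integrable_bound) (measurable, rule AE_I2, rule bound)
qed

quotient_type l2 = "complex \<Rightarrow> complex" / partial: l2_rel
  morphisms rep_l2 abs_l2
proof (rule part_equivpI)
  show "\<exists>f. l2_rel f f"
    by (rule exI[of _ "\<lambda>z. 0"]) (simp add: l2_rel_def)
  show "symp l2_rel"
    by (auto intro!: sympI simp: l2_rel_def)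
  show "transp l2_rel"
    by (auto intro!: transpI simp: l2_rel_def)
qed

text \<open>Inner product, linear in the first variable.\<close>

lift_definition cinner :: "l2 \<Rightarrow> l2 \<Rightarrow> complex"
  is "\<lambda>f g. LINT z|circle_measure. f z * cnj (g z)"
proof -
  fix f f' g g' assume *: "l2_rel f f'" "l2_rel g g'"
  then have "integrable circle_measure (\<lambda>z. f z * cnj (g z))"
    "integrable circle_measure (\<lambda>z. f' z * cnj (g' z))"
    by (auto simp: l2_rel_def intro!: integrable_mult_cnj)
  moreover have "AE z in circle_measure. f z * cnj (g z) = f' z * cnj (g' z)"
    using * unfolding l2_rel_def by auto
  ultimately show "(LINT z|circle_measure. f z * cnj (g z)) = (LINT z|circle_measure. f' z * cnj (g' z))"
    by (intro integral_cong_AE borel_measurable_integrable)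
qed

lift_definition scaleC :: "complex \<Rightarrow> l2 \<Rightarrow> l2"
  is "\<lambda>c f z. c * f z"
  unfolding l2_rel_def by (auto intro: square_integrable_cmult)

lift_definition cnj_l2 :: "l2 \<Rightarrow> l2"
  is "\<lambda>f z. cnj (f z)"
  unfolding l2_rel_def by (auto intro: square_integrable_cnj)

instantiation l2 :: real_vector
begin

lift_definition zero_l2 :: l2 is "\<lambda>z. 0"
  by (simp add: l2_rel_def)

lift_definition plus_l2 :: "l2 \<Rightarrow> l2 \<Rightarrow> l2" is "\<lambda>f g z. f z + g z"
  unfolding l2_rel_def by (auto intro: square_integrable_add)

definition scaleR_l2 :: "real \<Rightarrow> l2 \<Rightarrow> l2"
  where "scaleR_l2 r = scaleC (of_real r)"

definition uminus_l2 :: "l2 \<Rightarrow> l2"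
  where "uminus_l2 = scaleC (-1)"

definition minus_l2 :: "l2 \<Rightarrow> l2 \<Rightarrow> l2"
  where "minus_l2 f g = f + (- g)"

instance
proof
  fix f g k :: l2 and a b :: real
  have rel: "l2_rel p q"
    if "square_integrable p" "\<And>z. p z = q z" for p q
  proof -
    have "p = q" using that by auto
    then show ?thesis using that by (simp add: l2_rel_def)
  qed
  show "f + g + k = f + (g + k)"
    by transfer (rule rel; auto simp: l2_rel_def algebra_simps intro!: square_integrable_add)
  show "f + g = g + f"
    by transfer (rule rel; auto simp: l2_rel_def algebra_simps intro!: square_integrable_add)
  show "0 + f = f"
    by transfer (auto simp: l2_rel_def)
  show "- f + f = 0"
    unfolding uminus_l2_def by transfer (auto simp: l2_rel_def)
  show "f - g = f + - g"
    by (simp add: minus_l2_def)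
  show "a *\<^sub>R (f + g) = a *\<^sub>R f + a *\<^sub>R g"
    unfolding scaleR_l2_def
    by transfer (rule rel; auto simp: l2_rel_def algebra_simps
        intro!: square_integrable_add square_integrable_cmult)
  show "(a + b) *\<^sub>R f = a *\<^sub>R f + b *\<^sub>R f"
    unfolding scaleR_l2_def
    by transfer (rule rel; auto simp: l2_rel_def algebra_simps
        intro!: square_integrable_add square_integrable_cmult)
  show "a *\<^sub>R b *\<^sub>R f = (a * b) *\<^sub>R f"
    unfolding scaleR_l2_def
    by transfer (rule rel; auto simp: l2_rel_def algebra_simps intro!: square_integrable_cmult)
  show "1 *\<^sub>R f = f"
    unfolding scaleR_l2_def by transfer (auto simp: l2_rel_def)
qed

end

lemma cinner_commute: "cinner g f = cnj (cinner f g)"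
proof transfer
  fix f g
  have "(LINT z|circle_measure. g z * cnj (f z)) = (LINT z|circle_measure. cnj (f z * cnj (g z)))"
    by (simp only: complex_cnj_mult complex_cnj_cnj mult.commute)
  also have "\<dots> = cnj (LINT z|circle_measure. f z * cnj (g z))"
    by (rule Bochner_Integration.integral_cnj)
  finally show "(LINT z|circle_measure. g z * cnj (f z)) = cnj (LINT z|circle_measure. f z * cnj (g z))" .
qed

lemma cinner_add_left: "cinner (f + g) k = cinner f k + cinner g k"
  by transfer (auto simp: l2_rel_def distrib_right integrable_mult_cnj
      intro!: Bochner_Integration.integral_add)

lemma cinner_scaleC_left: "cinner (scaleC c f) g = c * cinner f g"
  by transfer (simp add: mult.assoc)

lemma cinner_self: "cinner f f = of_real (Re (cinner f f))" "0 \<le> Re (cinner f f)"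
proof -
  have "cinner f f = of_real (LINT z|circle_measure. (norm (rep_l2 f z))\<^sup>2)"
    unfolding cinner.rep_eq complex_norm_square[symmetric] of_real_power[symmetric]
    by (rule integral_complex_of_real)
  then show "cinner f f = of_real (Re (cinner f f))" "0 \<le> Re (cinner f f)"
    by simp_all
qed

lemma cinner_self_eq_0_iff: "Re (cinner f f) = 0 \<longleftrightarrow> f = 0"
proof (transfer, safe)
  fix f assume f: "l2_rel f f" and 0: "Re (LINT z|circle_measure. f z * cnj (f z)) = 0"
  have int: "integrable circle_measure (\<lambda>z. (norm (f z))\<^sup>2)"
    using f by (simp add: l2_rel_def square_integrable_def)
  have "(LINT z|circle_measure. f z * cnj (f z)) =
      of_real (LINT z|circle_measure. (norm (f z))\<^sup>2)"
    unfolding complex_norm_square[symmetric] of_real_power[symmetric]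
    by (rule integral_complex_of_real)
  then have "(LINT z|circle_measure. (norm (f z))\<^sup>2) = 0"
    using 0 by simp
  then have "AE z in circle_measure. (norm (f z))\<^sup>2 = 0"
    using integral_nonneg_eq_0_iff_AE[OF int] by simp
  then show "l2_rel f (\<lambda>z. 0)"
    using f by (simp add: l2_rel_def)
next
  fix f assume "l2_rel f f" "l2_rel f (\<lambda>z. 0)"
  then have "(LINT z|circle_measure. f z * cnj (f z)) = (LINT z|circle_measure. 0)"
    by (intro integral_cong_AE) (auto simp: l2_rel_def square_integrable_def)
  then show "Re (LINT z|circle_measure. f z * cnj (f z)) = 0"
    by simp
qed

text \<open>The library has no class of complex inner product spaces; norm and topology come from the
  real inner product \<open>Re \<langle>f, g\<rangle>\<close>.\<close>

instantiation l2 :: real_inner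
begin

definition inner_l2 :: "l2 \<Rightarrow> l2 \<Rightarrow> real"
  where "inner_l2 f g = Re (cinner f g)"

definition norm_l2 :: "l2 \<Rightarrow> real"
  where "norm_l2 f = sqrt (Re (cinner f f))"

definition sgn_l2 :: "l2 \<Rightarrow> l2"
  where "sgn_l2 f = inverse (norm f) *\<^sub>R f"

definition dist_l2 :: "l2 \<Rightarrow> l2 \<Rightarrow> real"
  where "dist_l2 f g = norm (f - g)"

definition uniformity_l2 :: "(l2 \<times> l2) filter"
  where "uniformity_l2 = (INF e\<in>{0 <..}. principal {(x, y). dist x y < e})"

definition open_l2 :: "l2 set \<Rightarrow> bool"
  where "open_l2 U \<longleftrightarrow> (\<forall>x\<in>U. eventually (\<lambda>(x', y). x' = x \<longrightarrow> y \<in> U) uniformity)"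

instance
proof
  fix f g k :: l2 and r :: real
  show "dist f g = norm (f - g)" by (fact dist_l2_def)
  show "sgn f = inverse (norm f) *\<^sub>R f" by (fact sgn_l2_def)
  show "f \<bullet> g = g \<bullet> f"
    unfolding inner_l2_def by (subst cinner_commute) simp
  show "(f + g) \<bullet> k = f \<bullet> k + g \<bullet> k"
    by (simp add: inner_l2_def cinner_add_left)
  show "r *\<^sub>R f \<bullet> g = r * (f \<bullet> g)"
    by (simp add: inner_l2_def scaleR_l2_def cinner_scaleC_left)
  show "0 \<le> f \<bullet> f"
    by (simp add: inner_l2_def cinner_self(2))
  show "f \<bullet> f = 0 \<longleftrightarrow> f = 0"
    by (simp add: inner_l2_def cinner_self_eq_0_iff)
  show "norm f = sqrt (f \<bullet> f)"
    by (simp add: inner_l2_def norm_l2_def)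
qed (fact uniformity_l2_def open_l2_def)+

end

text \<open>The class of a function; \<open>0\<close> if the function is not square-integrable.\<close>

lift_definition l2_of :: "(complex \<Rightarrow> complex) \<Rightarrow> l2"
  is "\<lambda>f. if square_integrable f then f else (\<lambda>z. 0)"
  by (simp add: l2_rel_def)

lift_definition product_in_l2 :: "l2 \<Rightarrow> l2 \<Rightarrow> bool"
  is "\<lambda>f g. square_integrable (\<lambda>z. f z * g z)"
  unfolding l2_rel_def
  by (intro square_integrable_AE_cong) (auto simp: square_integrable_def)

text \<open>\<open>mult_op f g\<close> is the pointwise product of the classes \<open>f\<close> and \<open>g\<close> whenever that
  product is square-integrable (always so for \<open>f\<close> essentially bounded), and \<open>0\<close> otherwise.\<close>

lift_definition mult_op :: "l2 \<Rightarrow> l2 \<Rightarrow> l2"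
  is "\<lambda>f g. if square_integrable (\<lambda>z. f z * g z) then (\<lambda>z. f z * g z) else (\<lambda>z. 0)"
proof -
  fix f f' g g' assume rel: "l2_rel f f'" "l2_rel g g'"
  then have "square_integrable (\<lambda>z. f z * g z) \<longleftrightarrow> square_integrable (\<lambda>z. f' z * g' z)"
    unfolding l2_rel_def
    by (intro square_integrable_AE_cong) (auto simp: square_integrable_def)
  then show "l2_rel
      (if square_integrable (\<lambda>z. f z * g z) then (\<lambda>z. f z * g z) else (\<lambda>z. 0))
      (if square_integrable (\<lambda>z. f' z * g' z) then (\<lambda>z. f' z * g' z) else (\<lambda>z. 0))"
    using rel by (auto simp: l2_rel_def)
qed

text \<open>\<open>L\<^sup>\<infinity>\<close>, as a subset of \<open>L\<^sup>2\<close> (the measure is finite).\<close>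

lift_definition essentially_bounded :: "l2 \<Rightarrow> bool"
  is "\<lambda>f. \<exists>C. AE z in circle_measure. norm (f z) \<le> C"
proof -
  fix f g assume "l2_rel f g"
  then have eq: "AE z in circle_measure. f z = g z"
    by (simp add: l2_rel_def)
  have "(AE z in circle_measure. norm (f z) \<le> C) \<longleftrightarrow> (AE z in circle_measure. norm (g z) \<le> C)" for C
    using eq by (auto elim: eventually_elim2)
  then show "(\<exists>C. AE z in circle_measure. norm (f z) \<le> C) \<longleftrightarrow>
      (\<exists>C. AE z in circle_measure. norm (g z) \<le> C)"
    by simp
qed

definition Linf :: "l2 set"
  where "Linf = {f. essentially_bounded f}"

lift_definition unimodular :: "l2 \<Rightarrow> bool"
  is "\<lambda>f. AE z in circle_measure. norm (f z) = 1"
  unfolding l2_rel_def by (auto elim: eventually_elim2)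


section \<open>Closed subspaces, orthogonality, projections, adjoints\<close>

definition closed_csubspace :: "l2 set \<Rightarrow> bool"
  where "closed_csubspace V \<longleftrightarrow> subspace V \<and> (\<forall>c. \<forall>f\<in>V. scaleC c f \<in> V) \<and> closed V"

definition ominus :: "l2 set \<Rightarrow> l2 set \<Rightarrow> l2 set"  (infixl "\<ominus>" 65)
  where "V \<ominus> W = {f\<in>V. \<forall>g\<in>W. cinner f g = 0}"

definition proj :: "l2 set \<Rightarrow> l2 \<Rightarrow> l2"
  where "proj V f = (THE g. g \<in> V \<and> (\<forall>v\<in>V. cinner (f - g) v = 0))"

definition orthogonal_sum :: "l2 set \<Rightarrow> l2 set \<Rightarrow> l2 set \<Rightarrow> bool"
  where "orthogonal_sum Z X Y \<longleftrightarrow>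
    closed_csubspace X \<and> closed_csubspace Y \<and> (\<forall>x\<in>X. \<forall>y\<in>Y. cinner x y = 0) \<and>
    Z = {x + y |x y. x \<in> X \<and> y \<in> Y}"

text \<open>An operator with domain \<open>V\<close> is an extensional function on \<open>V\<close>
  (\<open>undefined\<close> outside \<open>V\<close>). The adjoint of \<open>A : X \<rightarrow> Y\<close> is an operator with domain \<open>Y\<close>.\<close>

definition adjoint_on :: "l2 set \<Rightarrow> l2 set \<Rightarrow> (l2 \<Rightarrow> l2) \<Rightarrow> l2 \<Rightarrow> l2"
  where "adjoint_on X Y A =
    (\<lambda>g\<in>Y. THE f'. f' \<in> X \<and> (\<forall>f\<in>X. cinner (A f) g = cinner f f'))"

text \<open>The operator \<open>A\<close> on \<open>Z = X \<oplus> Y\<close> (orthogonal sum) has the block matrix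
  with rows \<open>A11, A12\<close> and \<open>A21, A22\<close>.\<close>

definition has_block_matrix ::
  "l2 set \<Rightarrow> l2 set \<Rightarrow> l2 set \<Rightarrow> (l2 \<Rightarrow> l2) \<Rightarrow>
    (l2 \<Rightarrow> l2) \<Rightarrow> (l2 \<Rightarrow> l2) \<Rightarrow> (l2 \<Rightarrow> l2) \<Rightarrow> (l2 \<Rightarrow> l2) \<Rightarrow> bool"
  where "has_block_matrix Z X Y A A11 A12 A21 A22 \<longleftrightarrow>
    orthogonal_sum Z X Y \<and>
    A \<in> Z \<rightarrow>\<^sub>E Z \<and>
    A11 \<in> X \<rightarrow>\<^sub>E X \<and> A12 \<in> Y \<rightarrow>\<^sub>E X \<and> A21 \<in> X \<rightarrow>\<^sub>E Y \<and> A22 \<in> Y \<rightarrow>\<^sub>E Y \<and>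
    (\<forall>x\<in>X. \<forall>y\<in>Y. A (x + y) = (A11 x + A12 y) + (A21 x + A22 y))"


section \<open>Hardy space, model spaces, nearly invariant subspaces\<close>

lift_definition fourier_coeff :: "l2 \<Rightarrow> int \<Rightarrow> complex"
  is "\<lambda>f n. LINT z|circle_measure. f z * cnj (z powi n)"
proof (rule ext)
  fix f g and n :: int assume *: "l2_rel f g"
  then have [measurable]: "f \<in> borel_measurable circle_measure" "g \<in> borel_measurable circle_measure"
    by (simp_all add: l2_rel_def square_integrable_def)
  have [measurable]: "(\<lambda>z :: complex. cnj (z powi n)) \<in> borel_measurable circle_measure"
    by (rule measurable_compose[OF _ borel_measurable_cnj]) (simp add: power_int_def)
  have "AE z in circle_measure. f z * cnj (z powi n) = g z * cnj (z powi n)"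
    using * unfolding l2_rel_def by auto
  then show "(LINT z|circle_measure. f z * cnj (z powi n)) = (LINT z|circle_measure. g z * cnj (z powi n))"
    by (intro integral_cong_AE) measurable
qed

definition H2 :: "l2 set"
  where "H2 = {f. \<forall>n<0. fourier_coeff f n = 0}"

definition H2minus :: "l2 set"
  where "H2minus = UNIV \<ominus> H2"

text \<open>For \<open>f\<close> in \<open>H2\<close>: the value at \<open>w\<close> of the associated analytic function on the unit disk.\<close>

definition disk_value :: "l2 \<Rightarrow> complex \<Rightarrow> complex"
  where "disk_value f w = (\<Sum>n. fourier_coeff f (int n) * w ^ n)"

definition backward_shift :: "l2 \<Rightarrow> l2"
  where "backward_shift f = mult_op (l2_of (\<lambda>z. 1 / z)) (f - l2_of (\<lambda>z. disk_value f 0))"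

definition inner_function :: "l2 \<Rightarrow> bool"
  where "inner_function u \<longleftrightarrow> u \<in> H2 \<and> unimodular u"

definition nonconstant :: "l2 \<Rightarrow> bool"
  where "nonconstant u \<longleftrightarrow> (\<nexists>c. u = l2_of (\<lambda>z. c))"

definition model_space :: "l2 \<Rightarrow> l2 set"
  where "model_space u = H2 \<ominus> mult_op u ` H2"

definition nearly_invariant :: "l2 set \<Rightarrow> bool"
  where "nearly_invariant M \<longleftrightarrow>
    (\<forall>f\<in>M. disk_value f 0 = 0 \<longrightarrow> backward_shift f \<in> M)"

definition extremal_function :: "l2 \<Rightarrow> l2 set \<Rightarrow> bool"
  where "extremal_function h M \<longleftrightarrow>
    h \<in> M \<and> norm h = 1 \<and>
    Im (disk_value h 0) = 0 \<and> Re (disk_value h 0) > 0 \<and>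
    (\<forall>f\<in>M. disk_value f 0 = 0 \<longrightarrow> cinner h f = 0)"

definition mult_isometry_onto :: "l2 \<Rightarrow> l2 set \<Rightarrow> l2 set \<Rightarrow> bool"
  where "mult_isometry_onto h K M \<longleftrightarrow>
    (\<forall>k\<in>K. product_in_l2 h k \<and> norm (mult_op h k) = norm k) \<and> mult_op h ` K = M"


section \<open>The operators\<close>

definition dual_toeplitz :: "l2 set \<Rightarrow> l2 \<Rightarrow> l2 \<Rightarrow> l2"
  where "dual_toeplitz M \<phi> = (\<lambda>f\<in>UNIV \<ominus> M. proj (UNIV \<ominus> M) (mult_op \<phi> f))"

definition compressed_toeplitz :: "l2 set \<Rightarrow> l2 \<Rightarrow> l2 \<Rightarrow> l2"
  where "compressed_toeplitz N \<phi> = (\<lambda>f\<in>N. proj N (mult_op \<phi> f))"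

definition hankel :: "l2 \<Rightarrow> l2 \<Rightarrow> l2"
  where "hankel \<alpha> = (\<lambda>f\<in>H2. proj H2minus (mult_op \<alpha> f))"

definition S_op :: "l2 \<Rightarrow> l2 \<Rightarrow> l2"
  where "S_op \<phi> = (\<lambda>g\<in>H2minus. proj H2minus (mult_op \<phi> g))"

end

theory Submission
  imports Defs "HOL-Probability.Probability_Measure"
begin

text \<open>Because \<open>M \<subseteq> H\<^sup>2\<close>, the space \<open>M\<^sup>\<bottom>\<close> splits orthogonally as \<open>N \<oplus> H\<^sup>2\<^sub>-\<close>, and the projection onto an
  orthogonal sum is the sum of the projections onto its summands
  (\<open>proj_orthogonal_sum\<close>). Applying this to \<open>\<phi>(x + y) = \<phi>x + \<phi>y\<close> with \<open>x \<in> N\<close> and \<open>y \<in> H\<^sup>2\<^sub>-\<close> yields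
  the four entries of the matrix. Three of them are the stated ones by definition; the
  upper right one is \<open>P\<^sub>N(\<phi>y) = P\<^sub>N P\<^sub>+(\<phi>y)\<close>, because \<open>N \<subseteq> H\<^sup>2\<close>, and \<open>P\<^sub>+ M\<^sub>\<phi>\<close> on \<open>H\<^sup>2\<^sub>-\<close> is the
  adjoint of the Hankel operator with symbol \<open>cnj \<phi>\<close>, because the adjoint of multiplication by
  \<open>cnj \<phi>\<close> is multiplication by \<open>\<phi>\<close>.

  The analytic content is that all these projections exist: \<open>proj\<close> is a definite description, so
  nothing can be said about it before the projection theorem is available for
  every closed subspace of \<open>L\<^sup>2\<close>. This rests on the completeness of \<open>L\<^sup>2\<close>, the Riesz-Fischer theorem.
  A sequence that is Cauchy fast enough converges almost everywhere, since its increments are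
  summable in \<open>L\<^sup>1\<close>, and Fatou's lemma turns the pointwise limit into a limit in norm.\<close>

section \<open>Completeness of the space of square-integrable functions\<close>

lemma measurable_cis_arc: "cis \<in> uniform_measure lborel {0..<2 * pi} \<rightarrow>\<^sub>M borel"
proof -
  have "cis \<in> borel \<rightarrow>\<^sub>M borel"
    by (intro borel_measurable_continuous_onI continuous_on_cis continuous_on_id)
  then show ?thesis
    by (simp cong: measurable_cong_sets)
qed

lemma prob_space_circle_measure: "prob_space circle_measure"
  unfolding circle_measure_def
proof (rule prob_space.prob_space_distr)
  show "prob_space (uniform_measure lborel {0..<2 * pi})"
    by (rule prob_space_uniform_measure) auto
qed (rule measurable_cis_arc)

interpretation circle: prob_space circle_measure
  by (rule prob_space_circle_measure)

lemma square_integrable_rep_l2: "square_integrable (rep_l2 f)"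
  using Quotient_rep_reflp[OF Quotient_l2] by (simp add: l2_rel_def)

lemma l2_of_rep_l2 [simp]: "l2_of (rep_l2 f) = f"
  by (simp add: l2_of.abs_eq l2_of_def square_integrable_rep_l2 Quotient_abs_rep[OF Quotient_l2])

lemma square_integrable_diff:
  assumes "square_integrable f" "square_integrable g"
  shows "square_integrable (\<lambda>z. f z - g z)"
  using square_integrable_add[OF assms(1) square_integrable_cmult(1)[OF assms(2), of "-1"]] by simp

lemma norm_l2_of_diff:
  assumes "square_integrable p" "square_integrable q"
  shows "(norm (l2_of p - l2_of q))\<^sup>2 = (LINT z|circle_measure. (norm (p z - q z))\<^sup>2)"
proof -
  have "cinner (l2_of p - l2_of q) (l2_of p - l2_of q)
      = (LINT z|circle_measure. (p z - q z) * cnj (p z - q z))"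
    unfolding minus_l2_def uminus_l2_def using assms by transfer simp
  also have "\<dots> = of_real (LINT z|circle_measure. (norm (p z - q z))\<^sup>2)"
    unfolding complex_norm_square[symmetric] of_real_power[symmetric]
    by (rule integral_complex_of_real)
  finally show ?thesis
    by (simp add: norm_l2_def)
qed

text \<open>On a probability space the \<open>L\<^sup>1\<close> norm is controlled by the \<open>L\<^sup>2\<close> norm; the integral of
  \<open>2ab \<le> a\<^sup>2 + b\<^sup>2\<close> with \<open>a = |f|\<close> and \<open>b = c\<close> suffices for this.\<close>

lemma nn_integral_norm_le:
  assumes "square_integrable f" and "(LINT z|circle_measure. (norm (f z))\<^sup>2) \<le> c\<^sup>2" and "c > 0"
  shows "(\<integral>\<^sup>+z. ennreal (norm (f z)) \<partial>circle_measure) \<le> ennreal c"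
proof -
  have int: "integrable circle_measure (\<lambda>z. (norm (f z))\<^sup>2)"
    using assms(1) by (simp add: square_integrable_def)
  have pt: "norm (f z) \<le> ((norm (f z))\<^sup>2 + c\<^sup>2) / (2 * c)" for z
    using sum_squares_bound[of "norm (f z)" c] \<open>c > 0\<close> by (simp add: field_simps)
  have "(\<integral>\<^sup>+z. ennreal (norm (f z)) \<partial>circle_measure)
      \<le> (\<integral>\<^sup>+z. ennreal (((norm (f z))\<^sup>2 + c\<^sup>2) / (2 * c)) \<partial>circle_measure)"
    using pt by (intro nn_integral_mono ennreal_leI)
  also have "\<dots> = ennreal (LINT z|circle_measure. ((norm (f z))\<^sup>2 + c\<^sup>2) / (2 * c))"
    using int \<open>c > 0\<close> by (intro nn_integral_eq_integral) auto
  also have "(LINT z|circle_measure. ((norm (f z))\<^sup>2 + c\<^sup>2) / (2 * c))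
      = ((LINT z|circle_measure. (norm (f z))\<^sup>2) + c\<^sup>2) / (2 * c)"
    using int by (simp add: circle.prob_space[simplified])
  also have "ennreal \<dots> \<le> ennreal c"
    using assms(2) \<open>c > 0\<close> by (intro ennreal_leI) (simp add: field_simps power2_eq_square)
  finally show ?thesis .
qed

text \<open>The \<open>L\<^sup>1\<close> norms of the increments are at most \<open>(1/2)\<^sup>k\<close>, so the sum of the absolute values of the
  increments has a finite integral and is therefore finite at almost every point; there the
  telescoping series converges absolutely.\<close>

lemma AE_convergent_of_fast_Cauchy:
  fixes p :: "nat \<Rightarrow> complex \<Rightarrow> complex"
  assumes sq: "\<And>k. square_integrable (p k)"
    and fast: "\<And>k. (LINT z|circle_measure. (norm (p (Suc k) z - p k z))\<^sup>2) \<le> ((1/2) ^ k)\<^sup>2"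
  shows "AE z in circle_measure. convergent (\<lambda>k. p k z)"
proof -
  have [measurable]: "p k \<in> borel_measurable circle_measure" for k
    using sq by (simp add: square_integrable_def)
  have "(\<integral>\<^sup>+z. (\<Sum>k. ennreal (norm (p (Suc k) z - p k z))) \<partial>circle_measure)
      = (\<Sum>k. \<integral>\<^sup>+z. ennreal (norm (p (Suc k) z - p k z)) \<partial>circle_measure)"
    by (rule nn_integral_suminf) measurable
  also have "\<dots> \<le> (\<Sum>k. ennreal ((1/2) ^ k))"
    using sq fast by (intro suminf_le nn_integral_norm_le square_integrable_diff) auto
  also have "\<dots> = ennreal (\<Sum>k. (1/2) ^ k)"
    by (rule suminf_ennreal2) (auto intro: summable_geometric)
  also have "\<dots> < top"
    by simp
  finally have "AE z in circle_measure. (\<Sum>k. ennreal (norm (p (Suc k) z - p k z))) \<noteq> top"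
    by (intro nn_integral_noteq_infinite[unfolded infinity_ennreal_def]) auto
  then show ?thesis
  proof eventually_elim
    case (elim z)
    then have "summable (\<lambda>k. norm (p (Suc k) z - p k z))"
      by (intro summable_suminf_not_top) auto
    then have "summable (\<lambda>k. p (Suc k) z - p k z)"
      by (rule summable_norm_cancel)
    then have "convergent (\<lambda>n. \<Sum>k<n. p (Suc k) z - p k z)"
      by (simp add: summable_iff_convergent)
    then have "convergent (\<lambda>n. p n z - p 0 z)"
      by (simp only: sum_lessThan_telescope[of "\<lambda>k. p k z"])
    then have "convergent (\<lambda>n. (p n z - p 0 z) + p 0 z)"
      by (intro convergent_add convergent_const)
    then show ?case by simp
  qed
qed

text \<open>A bound on the distances from \<open>g\<close> passes to the pointwise limit by Fatou's lemma. With \<open>g\<close> a member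
  of the sequence itself, this gives both that the limit is in \<open>L\<^sup>2\<close> and the rate of convergence.\<close>

lemma Fatou_square_integrable:
  fixes p :: "nat \<Rightarrow> complex \<Rightarrow> complex"
  assumes p: "\<And>k. square_integrable (p k)" and g: "square_integrable g"
    and q: "q \<in> borel_measurable circle_measure"
    and lim: "AE z in circle_measure. (\<lambda>k. p k z) \<longlonglongrightarrow> q z"
    and bound: "\<And>k. k \<ge> K \<Longrightarrow> (LINT z|circle_measure. (norm (p k z - g z))\<^sup>2) \<le> c"
  shows "square_integrable q" and "(LINT z|circle_measure. (norm (q z - g z))\<^sup>2) \<le> c"
proof -
  have [measurable]: "p k \<in> borel_measurable circle_measure" for k
    using p by (simp add: square_integrable_def)
  have [measurable]: "g \<in> borel_measurable circle_measure"
    using g by (simp add: square_integrable_def)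
  note q [measurable]
  have "0 \<le> (LINT z|circle_measure. (norm (p K z - g z))\<^sup>2)"
    by (rule Bochner_Integration.integral_nonneg) simp
  then have c: "0 \<le> c"
    using bound[OF order_refl] by (rule order_trans)
  have "(\<integral>\<^sup>+z. ennreal ((norm (q z - g z))\<^sup>2) \<partial>circle_measure)
      = (\<integral>\<^sup>+z. liminf (\<lambda>k. ennreal ((norm (p k z - g z))\<^sup>2)) \<partial>circle_measure)"
  proof (rule nn_integral_cong_AE)
    show "AE z in circle_measure. ennreal ((norm (q z - g z))\<^sup>2)
        = liminf (\<lambda>k. ennreal ((norm (p k z - g z))\<^sup>2))"
      using lim
    proof eventually_elim
      case (elim z)
      then have "(\<lambda>k. ennreal ((norm (p k z - g z))\<^sup>2)) \<longlonglongrightarrow> ennreal ((norm (q z - g z))\<^sup>2)"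
        by (intro tendsto_ennrealI tendsto_intros)
      then show ?case
        by (rule lim_imp_Liminf[symmetric, rotated]) simp
    qed
  qed
  also have "\<dots> \<le> liminf (\<lambda>k. \<integral>\<^sup>+z. ennreal ((norm (p k z - g z))\<^sup>2) \<partial>circle_measure)"
    by (rule nn_integral_liminf) measurable
  also have "\<dots> \<le> limsup (\<lambda>k. \<integral>\<^sup>+z. ennreal ((norm (p k z - g z))\<^sup>2) \<partial>circle_measure)"
    by (rule Liminf_le_Limsup) simp
  also have "\<dots> \<le> ennreal c"
  proof (rule Limsup_bounded, rule eventually_sequentiallyI)
    fix k assume "K \<le> k"
    have "(\<integral>\<^sup>+z. ennreal ((norm (p k z - g z))\<^sup>2) \<partial>circle_measure)
        = ennreal (LINT z|circle_measure. (norm (p k z - g z))\<^sup>2)"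
      using square_integrable_diff[OF p[of k] g]
      by (intro nn_integral_eq_integral) (auto simp: square_integrable_def)
    then show "(\<integral>\<^sup>+z. ennreal ((norm (p k z - g z))\<^sup>2) \<partial>circle_measure) \<le> ennreal c"
      using bound[OF \<open>K \<le> k\<close>] by (simp add: ennreal_leI)
  qed
  finally have le: "(\<integral>\<^sup>+z. ennreal ((norm (q z - g z))\<^sup>2) \<partial>circle_measure) \<le> ennreal c" .
  then have int: "integrable circle_measure (\<lambda>z. (norm (q z - g z))\<^sup>2)"
    by (intro integrableI_nonneg) (auto simp: order_le_less_trans)
  then have "ennreal (LINT z|circle_measure. (norm (q z - g z))\<^sup>2) \<le> ennreal c"
    using le by (subst (asm) nn_integral_eq_integral) auto
  then show "(LINT z|circle_measure. (norm (q z - g z))\<^sup>2) \<le> c"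
    using c by simp
  have "square_integrable (\<lambda>z. q z - g z)"
    using int by (simp add: square_integrable_def)
  from square_integrable_add[OF this g] show "square_integrable q"
    by simp
qed

instance l2 :: complete_space
proof
  fix X :: "nat \<Rightarrow> l2"
  assume "Cauchy X"
  then have "\<forall>k. \<exists>n0. \<forall>m\<ge>n0. \<forall>n\<ge>n0. dist (X m) (X n) < (1/2) ^ k"
    by (simp add: Cauchy_def)
  then obtain n0 where n0: "\<And>k m n. m \<ge> n0 k \<Longrightarrow> n \<ge> n0 k \<Longrightarrow> dist (X m) (X n) < (1/2) ^ k"
    by metis
  \<comment> \<open>Summing the thresholds makes every later index exceed the threshold of every earlier one.\<close>
  define r where "r k = (\<Sum>i\<le>k. n0 i)" for k
  have r: "n0 k \<le> r j" if "k \<le> j" for k j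
    unfolding r_def using that by (intro member_le_sum) auto
  define p where "p k = rep_l2 (X (r k))" for k
  have p: "square_integrable (p k)" for k
    by (simp add: p_def square_integrable_rep_l2)
  have [measurable]: "p k \<in> borel_measurable circle_measure" for k
    using p by (simp add: square_integrable_def)
  have fast: "(LINT z|circle_measure. (norm (p j z - p k z))\<^sup>2) \<le> ((1/2) ^ k)\<^sup>2" if "k \<le> j" for j k
  proof -
    have "norm (X (r j) - X (r k)) \<le> (1/2) ^ k"
      using n0[OF r[OF that] r[OF order_refl]] by (simp add: dist_norm)
    then show ?thesis
      unfolding norm_l2_of_diff[OF p p, symmetric] by (simp add: p_def)
  qed
  define q where "q z = lim (\<lambda>k. p k z)" for z
  have q: "q \<in> borel_measurable circle_measure"
    unfolding q_def by (rule borel_measurable_lim_metric) measurable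
  have "AE z in circle_measure. convergent (\<lambda>k. p k z)"
    using p fast by (intro AE_convergent_of_fast_Cauchy) auto
  then have lim: "AE z in circle_measure. (\<lambda>k. p k z) \<longlonglongrightarrow> q z"
    by eventually_elim (simp add: q_def convergent_LIMSEQ_iff)
  have q_sq: "square_integrable q"
    using p p q lim fast[of 0] by (rule Fatou_square_integrable(1))
  have q_le: "(LINT z|circle_measure. (norm (q z - p k z))\<^sup>2) \<le> ((1/2) ^ k)\<^sup>2" for k
    using p p q lim fast by (rule Fatou_square_integrable(2))
  have close: "dist (X (r k)) (l2_of q) \<le> (1/2) ^ k" for k
  proof (rule power2_le_imp_le)
    have "(norm (l2_of q - l2_of (p k)))\<^sup>2 \<le> ((1/2) ^ k)\<^sup>2"
      unfolding norm_l2_of_diff[OF q_sq p] by (rule q_le)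
    then show "(dist (X (r k)) (l2_of q))\<^sup>2 \<le> ((1/2) ^ k)\<^sup>2"
      by (simp add: p_def dist_norm norm_minus_commute)
  qed simp
  have "X \<longlonglongrightarrow> l2_of q"
  proof (rule metric_LIMSEQ_I)
    fix e :: real assume "e > 0"
    then obtain k where k: "(1/2) ^ k < e / 2"
      using real_arch_pow_inv[of "e / 2" "1 / 2"] by auto
    have "dist (X n) (l2_of q) < e" if "n \<ge> n0 k" for n
      using dist_triangle[of "X n" "l2_of q" "X (r k)"] n0[OF that r[OF order_refl]] close[of k] k
      by linarith
    then show "\<exists>n0. \<forall>n\<ge>n0. dist (X n) (l2_of q) < e"
      by blast
  qed
  then show "convergent X"
    by (rule convergentI)
qed


section \<open>The projection theorem\<close>

text \<open>By the parallelogram law, vectors of the subspace that nearly minimize the distance to \<open>x\<close> are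
  close to each other, because their midpoint cannot be nearer to \<open>x\<close> than the infimum. So a
  minimizing sequence is Cauchy, and its limit is the foot of the perpendicular from \<open>x\<close>.\<close>

lemma orthogonal_projection_exists:
  fixes V :: "'a::{real_inner, complete_space} set"
  assumes sub: "subspace V" and closed: "closed V"
  shows "\<exists>y\<in>V. \<forall>v\<in>V. (x - y) \<bullet> v = 0"
proof -
  define D where "D = (INF v\<in>V. (norm (x - v))\<^sup>2)"
  have bdd: "bdd_below ((\<lambda>v. (norm (x - v))\<^sup>2) ` V)"
    by (rule bdd_belowI[of _ 0]) auto
  have D_le: "D \<le> (norm (x - v))\<^sup>2" if "v \<in> V" for v
    unfolding D_def using bdd that by (rule cINF_lower)
  have "V \<noteq> {}"
    using subspace_0[OF sub] by auto
  then have "\<exists>v\<in>V. (norm (x - v))\<^sup>2 < D + inverse (real (Suc n))" for n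
    using cInf_lessD[of "(\<lambda>v. (norm (x - v))\<^sup>2) ` V" "D + inverse (real (Suc n))"]
    by (auto simp: D_def)
  then obtain v where vV: "\<And>n. v n \<in> V"
    and v: "\<And>n. (norm (x - v n))\<^sup>2 < D + inverse (real (Suc n))"
    by metis
  have parallelogram: "(norm (v m - v n))\<^sup>2 \<le> 2 * inverse (real (Suc m)) + 2 * inverse (real (Suc n))"
    for m n
  proof -
    have "(1/2) *\<^sub>R (v m + v n) \<in> V"
      using sub vV by (simp add: subspace_add subspace_scale)
    from D_le[OF this] have "4 * D \<le> 4 * (norm (x - (1/2) *\<^sub>R (v m + v n)))\<^sup>2"
      by simp
    also have "4 * (norm (x - (1/2) *\<^sub>R (v m + v n)))\<^sup>2 + (norm (v m - v n))\<^sup>2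
        = 2 * (norm (x - v m))\<^sup>2 + 2 * (norm (x - v n))\<^sup>2"
      by (simp add: power2_norm_eq_inner inner_diff_left inner_diff_right inner_add_left
          inner_add_right inner_commute algebra_simps)
    ultimately show ?thesis
      using v[of m] v[of n] by linarith
  qed
  have "Cauchy v"
  proof (rule metric_CauchyI)
    fix e :: real assume "e > 0"
    then obtain K where K: "inverse (real (Suc K)) < e\<^sup>2 / 4"
      using reals_Archimedean[of "e\<^sup>2 / 4"] by auto
    have "dist (v m) (v n) < e" if "m \<ge> K" "n \<ge> K" for m n
    proof -
      have "inverse (real (Suc m)) \<le> inverse (real (Suc K))" "inverse (real (Suc n)) \<le> inverse (real (Suc K))"
        using that by auto
      then have "(norm (v m - v n))\<^sup>2 < e\<^sup>2"
        using parallelogram[of m n] K by linarith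
      then show ?thesis
        using \<open>e > 0\<close> by (simp add: dist_norm power2_less_imp_less)
    qed
    then show "\<exists>K. \<forall>m\<ge>K. \<forall>n\<ge>K. dist (v m) (v n) < e"
      by blast
  qed
  then obtain y where y: "v \<longlonglongrightarrow> y"
    using Cauchy_convergent convergent_def by blast
  have yV: "y \<in> V"
    using closed vV y by (rule closed_sequentially)
  have "(\<lambda>n. (norm (x - v n))\<^sup>2) \<longlonglongrightarrow> (norm (x - y))\<^sup>2"
    by (intro tendsto_intros y)
  moreover have "(\<lambda>n. D + inverse (real (Suc n))) \<longlonglongrightarrow> D + 0"
    by (intro tendsto_intros LIMSEQ_inverse_real_of_nat)
  ultimately have min: "(norm (x - y))\<^sup>2 \<le> D"
    using v by (intro LIMSEQ_le[of _ "(norm (x - y))\<^sup>2" _ D]) (auto intro: less_imp_le)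
  have "(x - y) \<bullet> w = 0" if w: "w \<in> V" for w
  proof (cases "w = 0")
    case False
    \<comment> \<open>The point of the line \<open>y + t w\<close> nearest to \<open>x\<close> has this parameter.\<close>
    define t where "t = ((x - y) \<bullet> w) / (w \<bullet> w)"
    have expand: "(norm (a - t *\<^sub>R w))\<^sup>2 = (norm a)\<^sup>2 - 2 * t * (a \<bullet> w) + t * (t * (w \<bullet> w))" for a
      by (simp add: power2_norm_eq_inner inner_diff_left inner_diff_right inner_commute[of w a]
          algebra_simps)
    have ww: "w \<bullet> w > 0"
      using False by simp
    have "y + t *\<^sub>R w \<in> V"
      using sub w yV by (simp add: subspace_add subspace_scale)
    with min have "(norm (x - y))\<^sup>2 \<le> (norm (x - (y + t *\<^sub>R w)))\<^sup>2"
      using D_le order_trans by blast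
    also have "\<dots> = (norm ((x - y) - t *\<^sub>R w))\<^sup>2"
      by (simp add: algebra_simps)
    also have "\<dots> = (norm (x - y))\<^sup>2 - 2 * t * ((x - y) \<bullet> w) + t * (t * (w \<bullet> w))"
      by (rule expand)
    also have "t * (w \<bullet> w) = (x - y) \<bullet> w"
      using ww by (simp add: t_def)
    finally have "((x - y) \<bullet> w) * ((x - y) \<bullet> w) / (w \<bullet> w) \<le> 0"
      by (simp add: t_def)
    then have "((x - y) \<bullet> w) * ((x - y) \<bullet> w) \<le> 0"
      using ww by (simp add: divide_le_0_iff)
    then show ?thesis
      by (auto simp: mult_le_0_iff)
  qed simp
  then show ?thesis
    using yV by blast
qed

lemma cinner_add_right: "cinner f (g + k) = cinner f g + cinner f k"
  by (metis cinner_commute cinner_add_left complex_cnj_add)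

lemma cinner_scaleC_right: "cinner f (scaleC c g) = cnj c * cinner f g"
  by (metis cinner_commute cinner_scaleC_left complex_cnj_mult)

lemma cinner_diff_left: "cinner (f - g) k = cinner f k - cinner g k"
  by (simp add: minus_l2_def uminus_l2_def cinner_add_left cinner_scaleC_left)

lemma cinner_diff_right: "cinner f (g - k) = cinner f g - cinner f k"
  by (metis cinner_commute cinner_diff_left complex_cnj_diff)

lemma cinner_zero [simp]: "cinner 0 f = 0" "cinner f 0 = 0"
  using cinner_diff_left[of 0 0 f] cinner_diff_right[of f 0 0] by simp_all

lemma cinner_eq_0_commute: "cinner f g = 0 \<longleftrightarrow> cinner g f = 0"
  by (metis cinner_commute complex_cnj_zero)

lemma cinner_eq_inner: "cinner f g = Complex (f \<bullet> g) (f \<bullet> scaleC \<i> g)"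
  by (simp add: inner_l2_def cinner_scaleC_right complex_eq_iff)

lemma closed_csubspace_add: "closed_csubspace V \<Longrightarrow> f \<in> V \<Longrightarrow> g \<in> V \<Longrightarrow> f + g \<in> V"
  and closed_csubspace_diff: "closed_csubspace V \<Longrightarrow> f \<in> V \<Longrightarrow> g \<in> V \<Longrightarrow> f - g \<in> V"
  by (auto simp: closed_csubspace_def subspace_add subspace_diff)

lemma projection_unique:
  assumes "closed_csubspace V"
    and "g \<in> V" "\<And>v. v \<in> V \<Longrightarrow> cinner (f - g) v = 0"
    and "k \<in> V" "\<And>v. v \<in> V \<Longrightarrow> cinner (f - k) v = 0"
  shows "g = k"
proof -
  have "g - k \<in> V"
    using assms by (simp add: closed_csubspace_diff)
  then have "cinner (f - k) (g - k) = 0" "cinner (f - g) (g - k) = 0"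
    using assms by blast+
  moreover have "g - k = (f - k) - (f - g)"
    by simp
  ultimately have "cinner (g - k) (g - k) = 0"
    by (metis cinner_diff_left diff_self)
  then have "Re (cinner (g - k) (g - k)) = 0"
    by simp
  then show ?thesis
    by (simp only: cinner_self_eq_0_iff) simp
qed

lemma proj_eqI:
  assumes "closed_csubspace V" "g \<in> V" "\<And>v. v \<in> V \<Longrightarrow> cinner (f - g) v = 0"
  shows "proj V f = g"
  unfolding proj_def using assms projection_unique[OF assms(1)] by (intro the_equality) blast+

lemma proj_props:
  assumes "closed_csubspace V"
  shows proj_in: "proj V f \<in> V" and proj_orthogonal: "v \<in> V \<Longrightarrow> cinner (f - proj V f) v = 0"
proof -
  obtain g where g: "g \<in> V" "\<And>v. v \<in> V \<Longrightarrow> (f - g) \<bullet> v = 0"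
    using orthogonal_projection_exists[of V f] assms by (auto simp: closed_csubspace_def)
  \<comment> \<open>The real orthogonality to \<open>v\<close> and to \<open>\<i>v\<close> together is the complex one.\<close>
  have orth: "cinner (f - g) v = 0" if "v \<in> V" for v
    using g(2)[OF that] g(2)[of "scaleC \<i> v"] assms that
    by (simp add: cinner_eq_inner closed_csubspace_def complex_eq_iff)
  have "proj V f = g"
    using assms g(1) orth by (rule proj_eqI)
  then show "proj V f \<in> V" and "v \<in> V \<Longrightarrow> cinner (f - proj V f) v = 0"
    using g(1) orth by auto
qed

lemma cinner_proj_left:
  assumes "closed_csubspace V" "v \<in> V"
  shows "cinner (proj V f) v = cinner f v"
  using proj_orthogonal[OF assms, of f] by (simp add: cinner_diff_left)

lemma cinner_proj_right:
  assumes "closed_csubspace V" "v \<in> V"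
  shows "cinner v (proj V f) = cinner v f"
  using cinner_proj_left[OF assms, of f] by (metis cinner_commute)

lemma proj_add:
  assumes "closed_csubspace V"
  shows "proj V (f + g) = proj V f + proj V g"
  using assms
  by (intro proj_eqI)
    (simp_all add: closed_csubspace_add proj_in cinner_diff_left cinner_add_left cinner_proj_left)

lemma proj_proj_subset:
  assumes "closed_csubspace V" "closed_csubspace W" "V \<subseteq> W"
  shows "proj V (proj W f) = proj V f"
  using assms
  by (intro proj_eqI) (auto simp: proj_in cinner_diff_left cinner_proj_left subset_iff)

lemma closed_csubspace_UNIV: "closed_csubspace UNIV"
  by (simp add: closed_csubspace_def)

text \<open>Complex orthogonality to \<open>g\<close> is real orthogonality to both \<open>g\<close> and \<open>\<i>g\<close>, which exhibits the
  complement as an intersection of kernels of continuous functionals.\<close>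

lemma closed_csubspace_ominus:
  assumes V: "closed_csubspace V"
  shows "closed_csubspace (V \<ominus> W)"
proof -
  have "V \<ominus> W = V \<inter> (\<Inter>g\<in>W. {f. f \<bullet> g = 0} \<inter> {f. f \<bullet> scaleC \<i> g = 0})"
    by (auto simp: ominus_def cinner_eq_inner complex_eq_iff)
  moreover have "closed \<dots>"
    using V unfolding closed_csubspace_def
    by (intro closed_Int closed_INT ballI closed_Collect_eq continuous_intros) auto
  ultimately have "closed (V \<ominus> W)"
    by simp
  moreover have "subspace (V \<ominus> W)"
    using V unfolding closed_csubspace_def subspace_def
    by (auto simp: ominus_def cinner_add_left scaleR_l2_def cinner_scaleC_left)
  ultimately show ?thesis
    using V by (auto simp: closed_csubspace_def ominus_def cinner_scaleC_left)
qed

lemma proj_orthogonal_sum: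
  assumes sum: "orthogonal_sum Z X Y" and Z: "closed_csubspace Z"
  shows "proj Z f = proj X f + proj Y f"
proof (rule proj_eqI[OF Z])
  have X: "closed_csubspace X" and Y: "closed_csubspace Y"
    and orth: "\<And>x y. x \<in> X \<Longrightarrow> y \<in> Y \<Longrightarrow> cinner x y = 0"
    and Z_eq: "Z = {x + y |x y. x \<in> X \<and> y \<in> Y}"
    using sum by (auto simp: orthogonal_sum_def)
  show "proj X f + proj Y f \<in> Z"
    unfolding Z_eq using proj_in[OF X] proj_in[OF Y] by blast
  fix v assume "v \<in> Z"
  then obtain x y where v: "v = x + y" "x \<in> X" "y \<in> Y"
    by (auto simp: Z_eq)
  have "cinner (proj Y f) x = 0"
    using orth[OF v(2) proj_in[OF Y]] by (simp add: cinner_eq_0_commute)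
  then show "cinner (f - (proj X f + proj Y f)) v = 0"
    using v X Y orth[OF proj_in[OF X] v(3)]
    by (simp add: cinner_diff_left cinner_add_left cinner_add_right cinner_proj_left)
qed


section \<open>The Hardy space and bounded multipliers\<close>

lemma AE_circle_norm: "AE z in circle_measure. norm z = 1"
  unfolding circle_measure_def using measurable_cis_arc by (subst AE_distr_iff) auto

lemma square_integrable_powi: "square_integrable (\<lambda>z. z powi n)"
proof -
  have meas: "(\<lambda>z :: complex. z powi n) \<in> borel_measurable circle_measure"
    by (simp add: power_int_def)
  have "AE z in circle_measure. (norm (z powi n))\<^sup>2 \<le> 1"
    using AE_circle_norm by eventually_elim (simp add: norm_power_int)
  then have "integrable circle_measure (\<lambda>z. (norm (z powi n))\<^sup>2)"
    using meas by (intro circle.integrable_const_bound[of _ 1]) auto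
  with meas show ?thesis
    by (simp add: square_integrable_def)
qed

lemma fourier_coeff_eq_cinner: "fourier_coeff f n = cinner f (l2_of (\<lambda>z. z powi n))"
  by transfer (simp add: square_integrable_powi)

text \<open>The defining conditions are orthogonality to the monomials with negative exponent, and an
  orthogonal complement is always a closed subspace.\<close>

lemma closed_csubspace_H2: "closed_csubspace H2"
proof -
  have "H2 = UNIV \<ominus> (\<lambda>n. l2_of (\<lambda>z. z powi n)) ` {..<0}"
    by (auto simp: H2_def ominus_def fourier_coeff_eq_cinner)
  then show ?thesis
    by (metis closed_csubspace_ominus closed_csubspace_UNIV)
qed

lemma closed_csubspace_H2minus: "closed_csubspace H2minus"
  unfolding H2minus_def by (intro closed_csubspace_ominus closed_csubspace_UNIV)

lemma square_integrable_bounded_mult: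
  assumes "square_integrable p" "square_integrable f"
    and "AE z in circle_measure. norm (p z) \<le> C"
  shows "square_integrable (\<lambda>z. p z * f z)"
proof -
  have [measurable]: "p \<in> borel_measurable circle_measure" "f \<in> borel_measurable circle_measure"
    using assms by (auto simp: square_integrable_def)
  have bound: "AE z in circle_measure. norm ((norm (p z * f z))\<^sup>2) \<le> norm (C\<^sup>2 * (norm (f z))\<^sup>2)"
    using assms(3)
  proof eventually_elim
    case (elim z)
    then have "(norm (p z))\<^sup>2 \<le> C\<^sup>2"
      by (intro power_mono) auto
    then show ?case
      by (simp add: norm_mult power_mult_distrib mult_right_mono)
  qed
  have "integrable circle_measure (\<lambda>z. C\<^sup>2 * (norm (f z))\<^sup>2)"
    using assms(2) by (simp add: square_integrable_def)
  then have "integrable circle_measure (\<lambda>z. (norm (p z * f z))\<^sup>2)"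
    by (rule Bochner_Integration.integrable_bound) (measurable, rule bound)
  then show ?thesis
    by (simp add: square_integrable_def)
qed

lemma cnj_l2_Linf: "\<phi> \<in> Linf \<Longrightarrow> cnj_l2 \<phi> \<in> Linf"
  unfolding Linf_def mem_Collect_eq by transfer simp

lemma mult_op_add:
  assumes "\<phi> \<in> Linf"
  shows "mult_op \<phi> (f + g) = mult_op \<phi> f + mult_op \<phi> g"
  using assms unfolding Linf_def mem_Collect_eq
proof transfer
  fix \<phi> f g
  assume rel: "l2_rel \<phi> \<phi>" "l2_rel f f" "l2_rel g g"
    and "\<exists>C. AE z in circle_measure. norm (\<phi> z) \<le> C"
  then have mult: "square_integrable (\<lambda>z. \<phi> z * k z)" if "square_integrable k" for k
    using square_integrable_bounded_mult that by (auto simp: l2_rel_def)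
  have "square_integrable f" "square_integrable g" "square_integrable (\<lambda>z. f z + g z)"
    using rel by (auto simp: l2_rel_def square_integrable_add)
  from this[THEN mult] show "l2_rel
      (if square_integrable (\<lambda>z. \<phi> z * (f z + g z)) then \<lambda>z. \<phi> z * (f z + g z) else (\<lambda>z. 0))
      (\<lambda>z. (if square_integrable (\<lambda>z. \<phi> z * f z) then \<lambda>z. \<phi> z * f z else (\<lambda>z. 0)) z +
        (if square_integrable (\<lambda>z. \<phi> z * g z) then \<lambda>z. \<phi> z * g z else (\<lambda>z. 0)) z)"
    by (simp add: l2_rel_def distrib_left)
qed

lemma cinner_mult_op_cnj:
  assumes "\<phi> \<in> Linf"
  shows "cinner (mult_op (cnj_l2 \<phi>) f) g = cinner f (mult_op \<phi> g)"
  using assms unfolding Linf_def mem_Collect_eq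
proof transfer
  fix \<phi> f g
  assume rel: "l2_rel \<phi> \<phi>" "l2_rel f f" "l2_rel g g"
    and "\<exists>C. AE z in circle_measure. norm (\<phi> z) \<le> C"
  then obtain C where C: "AE z in circle_measure. norm (\<phi> z) \<le> C"
    by blast
  have sq: "square_integrable \<phi>" "square_integrable f" "square_integrable g"
    using rel by (auto simp: l2_rel_def)
  have "square_integrable (\<lambda>z. \<phi> z * g z)"
    using sq(1,3) C by (rule square_integrable_bounded_mult)
  moreover have "square_integrable (\<lambda>z. cnj (\<phi> z) * f z)"
    using sq C by (intro square_integrable_bounded_mult[of _ _ C] square_integrable_cnj) auto
  ultimately show "(LINT z|circle_measure.
        (if square_integrable (\<lambda>z. cnj (\<phi> z) * f z) then \<lambda>z. cnj (\<phi> z) * f z else (\<lambda>z. 0)) z * cnj (g z)) =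
      (LINT z|circle_measure.
        f z * cnj ((if square_integrable (\<lambda>z. \<phi> z * g z) then \<lambda>z. \<phi> z * g z else (\<lambda>z. 0)) z))"
    by (simp add: mult_ac)
qed


section \<open>The adjoint of a Hankel operator and the block decomposition\<close>

lemma adjoint_on_eqI:
  assumes X: "closed_csubspace X"
    and B: "\<And>g. g \<in> Y \<Longrightarrow> B g \<in> X"
    and adj: "\<And>f g. f \<in> X \<Longrightarrow> g \<in> Y \<Longrightarrow> cinner (A f) g = cinner f (B g)"
  shows "adjoint_on X Y A = (\<lambda>g\<in>Y. B g)"
  unfolding adjoint_on_def
proof (rule restrict_ext, rule the_equality)
  fix g assume g: "g \<in> Y"
  then show "B g \<in> X \<and> (\<forall>f\<in>X. cinner (A f) g = cinner f (B g))"
    using B adj by blast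
  fix k assume k: "k \<in> X \<and> (\<forall>f\<in>X. cinner (A f) g = cinner f k)"
  then have "cinner v (B g - k) = 0" if "v \<in> X" for v
    using adj[OF that g] that by (simp add: cinner_diff_right)
  then show "k = B g"
    using k B[OF g] X projection_unique[of X k "B g" "B g"] by (simp add: cinner_eq_0_commute)
qed

text \<open>For \<open>f \<in> H\<^sup>2\<close> and \<open>g \<in> H\<^sup>2\<^sub>-\<close> the projections can be dropped and inserted freely:
  \<open>\<langle>P\<^sub>-(cnj \<phi> f), g\<rangle> = \<langle>cnj \<phi> f, g\<rangle> = \<langle>f, \<phi> g\<rangle> = \<langle>f, P\<^sub>+(\<phi> g)\<rangle>\<close>.\<close>

lemma adjoint_hankel_cnj:
  assumes "\<phi> \<in> Linf"
  shows "adjoint_on H2 H2minus (hankel (cnj_l2 \<phi>)) = (\<lambda>g\<in>H2minus. proj H2 (mult_op \<phi> g))"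
proof (rule adjoint_on_eqI[OF closed_csubspace_H2])
  show "proj H2 (mult_op \<phi> g) \<in> H2" for g
    by (rule proj_in[OF closed_csubspace_H2])
  show "cinner (hankel (cnj_l2 \<phi>) f) g = cinner f (proj H2 (mult_op \<phi> g))"
    if "f \<in> H2" "g \<in> H2minus" for f g
    using that assms
    by (simp add: hankel_def cinner_proj_left[OF closed_csubspace_H2minus]
        cinner_proj_right[OF closed_csubspace_H2] cinner_mult_op_cnj)
qed

text \<open>A vector orthogonal to \<open>M\<close> splits as its projection onto \<open>V\<close> plus the remainder. The remainder
  is orthogonal to \<open>V\<close>, hence to \<open>M\<close>, so the projection is orthogonal to \<open>M\<close> as well.\<close>

lemma orthogonal_sum_complement:
  assumes V: "closed_csubspace V" and "M \<subseteq> V"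
  shows "orthogonal_sum (UNIV \<ominus> M) (V \<ominus> M) (UNIV \<ominus> V)"
  unfolding orthogonal_sum_def
proof (intro conjI ballI)
  show "closed_csubspace (V \<ominus> M)" "closed_csubspace (UNIV \<ominus> V)"
    by (intro closed_csubspace_ominus V closed_csubspace_UNIV)+
  show "cinner x y = 0" if "x \<in> V \<ominus> M" "y \<in> UNIV \<ominus> V" for x y
    using that by (auto simp: ominus_def cinner_eq_0_commute[of x y])
  show "UNIV \<ominus> M = {x + y |x y. x \<in> V \<ominus> M \<and> y \<in> UNIV \<ominus> V}"
  proof (intro equalityI subsetI)
    fix f assume f: "f \<in> UNIV \<ominus> M"
    have "cinner (proj V f) g = 0" if "g \<in> M" for g
      using f that \<open>M \<subseteq> V\<close> by (auto simp: ominus_def cinner_proj_left[OF V])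
    then have "proj V f \<in> V \<ominus> M"
      by (simp add: ominus_def proj_in[OF V])
    moreover have "f - proj V f \<in> UNIV \<ominus> V"
      by (simp add: ominus_def proj_orthogonal[OF V])
    moreover have "f = proj V f + (f - proj V f)"
      by simp
    ultimately show "f \<in> {x + y |x y. x \<in> V \<ominus> M \<and> y \<in> UNIV \<ominus> V}"
      by blast
  next
    fix f assume "f \<in> {x + y |x y. x \<in> V \<ominus> M \<and> y \<in> UNIV \<ominus> V}"
    then show "f \<in> UNIV \<ominus> M"
      using \<open>M \<subseteq> V\<close> by (auto simp: ominus_def cinner_add_left)
  qed
qed

theorem theorem3p16:
  fixes M N :: "l2 set" and u h \<phi> :: l2
  assumes "M \<subseteq> H2" and "closed_csubspace M" and "M \<noteq> {0}" and "M \<noteq> H2"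
    and "nearly_invariant M"
    and "inner_function u" and "nonconstant u" and "disk_value u 0 = 0"
    and "extremal_function h M"
    and "mult_isometry_onto h (model_space u) M"
    and "\<phi> \<in> Linf"
    and "N = H2 \<ominus> M"
  shows "adjoint_on H2 H2minus (hankel (cnj_l2 \<phi>)) = (\<lambda>g\<in>H2minus. proj H2 (mult_op \<phi> g)) \<and>
    has_block_matrix (UNIV \<ominus> M) N H2minus (dual_toeplitz M \<phi>)
      (compressed_toeplitz N \<phi>)
      (compose H2minus (proj N) (adjoint_on H2 H2minus (hankel (cnj_l2 \<phi>))))
      (restrict (hankel \<phi>) N)
      (S_op \<phi>)"
proof (intro conjI)
  note \<phi> = \<open>\<phi> \<in> Linf\<close>
  show adj: "adjoint_on H2 H2minus (hankel (cnj_l2 \<phi>)) = (\<lambda>g\<in>H2minus. proj H2 (mult_op \<phi> g))"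
    using \<phi> by (rule adjoint_hankel_cnj)
  have sum: "orthogonal_sum (UNIV \<ominus> M) N H2minus"
    using orthogonal_sum_complement[OF closed_csubspace_H2 \<open>M \<subseteq> H2\<close>] \<open>N = H2 \<ominus> M\<close>
    by (simp add: H2minus_def)
  have Z: "closed_csubspace (UNIV \<ominus> M)"
    by (intro closed_csubspace_ominus closed_csubspace_UNIV)
  have N: "closed_csubspace N" and Y: "closed_csubspace H2minus" and NH: "N \<subseteq> H2"
    using sum \<open>N = H2 \<ominus> M\<close> by (auto simp: orthogonal_sum_def ominus_def)
  have upper_right: "proj N (proj H2 (mult_op \<phi> y)) = proj N (mult_op \<phi> y)" for y
    using N closed_csubspace_H2 NH by (rule proj_proj_subset)
  have split: "dual_toeplitz M \<phi> (x + y) =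
      (proj N (mult_op \<phi> x) + proj N (mult_op \<phi> y)) +
      (proj H2minus (mult_op \<phi> x) + proj H2minus (mult_op \<phi> y))"
    if "x \<in> N" "y \<in> H2minus" for x y
  proof -
    have "x + y \<in> UNIV \<ominus> M"
      using sum that by (auto simp: orthogonal_sum_def)
    then show ?thesis
      by (simp add: dual_toeplitz_def mult_op_add[OF \<phi>] proj_orthogonal_sum[OF sum Z]
          proj_add[OF N] proj_add[OF Y])
  qed
  show "has_block_matrix (UNIV \<ominus> M) N H2minus (dual_toeplitz M \<phi>)
      (compressed_toeplitz N \<phi>)
      (compose H2minus (proj N) (adjoint_on H2 H2minus (hankel (cnj_l2 \<phi>))))
      (restrict (hankel \<phi>) N)
      (S_op \<phi>)"
    unfolding has_block_matrix_def adj
  proof (intro conjI ballI)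
    show "dual_toeplitz M \<phi> \<in> (UNIV \<ominus> M) \<rightarrow>\<^sub>E (UNIV \<ominus> M)"
      by (auto simp: dual_toeplitz_def proj_in[OF Z])
    show "compressed_toeplitz N \<phi> \<in> N \<rightarrow>\<^sub>E N"
      by (auto simp: compressed_toeplitz_def proj_in[OF N])
    show "compose H2minus (proj N) (\<lambda>g\<in>H2minus. proj H2 (mult_op \<phi> g)) \<in> H2minus \<rightarrow>\<^sub>E N"
      by (auto simp: compose_def proj_in[OF N])
    show "restrict (hankel \<phi>) N \<in> N \<rightarrow>\<^sub>E H2minus"
      using NH by (auto simp: hankel_def proj_in[OF Y])
    show "S_op \<phi> \<in> H2minus \<rightarrow>\<^sub>E H2minus"
      by (auto simp: S_op_def proj_in[OF Y])
    fix x y assume x: "x \<in> N" and y: "y \<in> H2minus"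
    then have "x \<in> H2"
      using NH by blast
    with x y show "dual_toeplitz M \<phi> (x + y) =
        (compressed_toeplitz N \<phi> x +
          compose H2minus (proj N) (\<lambda>g\<in>H2minus. proj H2 (mult_op \<phi> g)) y) +
        (restrict (hankel \<phi>) N x + S_op \<phi> y)"
      by (simp add: split compressed_toeplitz_def compose_def hankel_def S_op_def upper_right)
  qed (rule sum)
qed

end
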